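(* Let $\lambda_0\in\mathbb{N}$, $\nu\in\mathbb{N}\setminus\{0\}$ and $\lambda_k=\lambda_0+k\nu$ for $k\ge 0$. Let $\mathcal{L}^+(\hat\lambda,\nu)$ be the loss function of this restart strategy, and let $$\mathcal{L}^+_{\mathrm{up}}(\hat\lambda,\nu)=\frac12\left(\hat\lambda-\lambda_0-1\right)\left(\frac{\hat\lambda+\lambda_0-1}{\nu}+1\right)+\lambda_0+\nu-1.$$ Then $\mathcal{L}^+_{\mathrm{up}}(\hat\lambda,\nu)$ is an upper bound of $\mathcal{L}^+(\hat\lambda,\nu)$, i.e. $\mathcal{L}^+(\hat\lambda,\nu)\le\mathcal{L}^+_{\mathrm{up}}(\hat\lambda,\nu)$ for all integers $\hat\lambda\ge\lambda_0$.
   Context: For a restart strategy $(\lambda_0,\lambda_1,\lambda_2,\ldots)$ (an unbounded sequence of natural numbers) and an integer $\hat\lambda\ge\lambda_0$, let $\hat k(\hat\lambda)=\min\{k\ge 0:\lambda_k\ge\hat\lambda\}$. The loss function is $\mathcal{L}(\hat\lambda)=\sum_{k=0}^{\hat k(\hat\lambda)}\lambda_k-\hat\lambda$; it is denoted $\mathcal{L}^+(\hat\lambda,\nu)$ for the additive strategy $\lambda_k=\lambda_0+k\nu$. *)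

theory Defs
  imports Complex_Main
begin

definition restart_strategy :: "(nat \<Rightarrow> nat) \<Rightarrow> bool" where
  "restart_strategy s \<longleftrightarrow> \<not> bdd_above (range s)"

text \<open>For a restart strategy the minimum exists, by unboundedness.\<close>

definition khat :: "(nat \<Rightarrow> nat) \<Rightarrow> int \<Rightarrow> nat" where
  "khat s l = (LEAST k. int (s k) \<ge> l)"

definition loss :: "(nat \<Rightarrow> nat) \<Rightarrow> int \<Rightarrow> int" where
  "loss s l = (\<Sum>k = 0..khat s l. int (s k)) - l"

definition additive_strategy :: "nat \<Rightarrow> nat \<Rightarrow> nat \<Rightarrow> nat" where
  "additive_strategy l0 \<nu> k = l0 + k * \<nu>"

lemma restart_strategy_additive:
  assumes "\<nu> \<noteq> 0"
  shows "restart_strategy (additive_strategy l0 \<nu>)"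
  unfolding restart_strategy_def
proof
  assume "bdd_above (range (additive_strategy l0 \<nu>))"
  then obtain B where B: "\<And>k. additive_strategy l0 \<nu> k \<le> B"
    by (auto simp: bdd_above_def)
  have "Suc B * 1 \<le> Suc B * \<nu>"
    using assms by (intro mult_le_mono2) simp
  with B[of "Suc B"] show False
    by (simp add: additive_strategy_def)
qed

text \<open>The initial value \<open>l0\<close>, usually left implicit in the notation, is an
  explicit argument of the additive loss and of its bound.\<close>

definition loss_add :: "nat \<Rightarrow> int \<Rightarrow> nat \<Rightarrow> int" where
  "loss_add l0 l \<nu> = loss (additive_strategy l0 \<nu>) l"

definition loss_add_up :: "nat \<Rightarrow> int \<Rightarrow> nat \<Rightarrow> real" where
  "loss_add_up l0 l \<nu> =
     1 / 2 * (real_of_int l - real l0 - 1) * ((real_of_int l + real l0 - 1) / real \<nu> + 1)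
       + real l0 + real \<nu> - 1"

end

theory Submission
  imports Defs
begin

text \<open>Minimality of \<open>k = khat\<close> gives \<open>\<nu> * k \<le> l - l0 + \<nu> - 1\<close>, that is
  \<open>k \<le> x + 1\<close> for \<open>x = (l - l0 - 1) / \<nu>\<close>. The loss \<open>k * l0 + \<nu> * k * (k + 1) / 2 - (l - l0)\<close>
  is increasing in \<open>k\<close>, and substituting \<open>x + 1\<close> for \<open>k\<close> yields exactly the bound.\<close>

lemma khat_additive_le:
  fixes l :: int
  assumes "\<nu> \<noteq> 0" and "l \<ge> int l0"
  shows "int (khat (additive_strategy l0 \<nu>) l * \<nu>) \<le> l - int l0 + int \<nu> - 1"
proof (cases "khat (additive_strategy l0 \<nu>) l")
  case 0
  \<comment> \<open>No earlier index exists here; the right side is nonnegative because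
    \<open>l \<ge> int l0\<close> and \<open>\<nu> \<ge> 1\<close>.\<close>
  with assms show ?thesis by simp
next
  case (Suc j)
  \<comment> \<open>The term at \<open>j\<close> falls short of \<open>l\<close>, so by integrality
    it is at most \<open>l - 1\<close>; the next term is larger by \<open>\<nu>\<close>.\<close>
  then have "\<not> int (additive_strategy l0 \<nu> j) \<ge> l"
    unfolding khat_def using not_less_Least by (metis lessI)
  with Suc show ?thesis
    by (simp add: additive_strategy_def algebra_simps)
qed

lemma sum_additive_strategy:
  "(\<Sum>k = 0..n. real (additive_strategy l0 \<nu> k)) =
     (real n + 1) * real l0 + real \<nu> * real n * (real n + 1) / 2"
  by (induction n) (simp_all add: additive_strategy_def field_simps)

theorem theorem1:
  fixes l0 \<nu> :: nat
  assumes "\<nu> \<noteq> 0"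
  shows "\<forall>l::int. l \<ge> int l0 \<longrightarrow> real_of_int (loss_add l0 l \<nu>) \<le> loss_add_up l0 l \<nu>"
proof (intro allI impI)
  fix l :: int
  assume l: "l \<ge> int l0"
  define k where "k = khat (additive_strategy l0 \<nu>) l"
  define x where "x = (real_of_int l - real l0 - 1) / real \<nu>"
  have pos: "real \<nu> > 0" using assms by simp
  have l_eq: "real_of_int l = real \<nu> * x + real l0 + 1"
    using pos by (simp add: x_def)
  have "real_of_int (int (k * \<nu>)) \<le> real_of_int (l - int l0 + int \<nu> - 1)"
    using khat_additive_le[OF assms l] unfolding k_def of_int_le_iff .
  then have "real k * real \<nu> \<le> (x + 1) * real \<nu>"
    by (simp add: l_eq algebra_simps)
  then have k_le: "real k \<le> x + 1" using pos by simp
  have "real_of_int (loss_add l0 l \<nu>) =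
      real k * real l0 + real \<nu> * (real k * (real k + 1)) / 2 - real \<nu> * x - 1"
    by (simp add: loss_add_def loss_def sum_additive_strategy l_eq algebra_simps flip: k_def)
  \<comment> \<open>For \<open>l = int l0\<close> the number \<open>x\<close> is negative, but
    \<open>0 \<le> real k \<le> x + 1\<close> always holds, so the products are monotone.\<close>
  also have "\<dots> \<le> (x + 1) * real l0 + real \<nu> * ((x + 1) * ((x + 1) + 1)) / 2 - real \<nu> * x - 1"
    using k_le by (intro diff_right_mono add_mono divide_right_mono mult_left_mono
        mult_right_mono mult_mono) auto
  also have "\<dots> = loss_add_up l0 l \<nu>"
    using pos by (simp add: loss_add_up_def l_eq field_simps)
  finally show "real_of_int (loss_add l0 l \<nu>) \<le> loss_add_up l0 l \<nu>" .
qed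

end
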